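(* Let $K$ be a pathwise connected poset and $G$ a group. There is, up to equivalence, a one-to-one correspondence between flat connections on principal net bundles over $K$ with structure group $G$ and group homomorphisms from the fundamental group $\pi_1(K)$ of the poset $K$ to $G$; i.e. a bijection between the set of equivalence classes of flat connections and the set of equivalence classes of group homomorphisms $\pi_1(K)\to G$.
   Context: Simplices of a poset $K$: $\tilde\Sigma_n(K)$ is the set of order-preserving maps from the poset of non-empty subsets of $\{0,\dots,n\}$ to $K$. So $\tilde\Sigma_0(K)=K$; a $1$-simplex $b=(|b|;\partial_0b,\partial_1b)$ consists of elements of $K$ with $\partial_0b,\partial_1b\le|b|$; a $2$-simplex $c$ consists of a support $|c|\in K$ and $1$-simplices $\partial_0c,\partial_1c,\partial_2c$ with $|\partial_ic|\le|c|$, $\partial_0\partial_0c=\partial_0\partial_1c$, $\partial_1\partial_0c=\partial_0\partial_2c$, $\partial_1\partial_1c=\partial_1\partial_2c$. The reverse of $b$ is $\overline b=(|b|;\partial_1b,\partial_0b)$; $\sigma_0a=(a;a,a)$. Nerve: $\Sigma_1(K)$ consists of pairs $(a,\tilde a)$ with $\tilde a\le a$, $0$-face $a$, $1$-face $\tilde a$, identified with $(a;a,\tilde a)$; $\Sigma_2(K)\subseteq\tilde\Sigma_2(K)$ consists of chains $v_0\le v_1\le v_2$ with $\partial_0c=(v_2,v_1)$, $\partial_1c=(v_2,v_0)$, $\partial_2c=(v_1,v_0)$, $|c|=v_2$. Paths and $\pi_1(K)$: a path is $p=b_n*\cdots*b_1$ with $b_i\in\tilde\Sigma_1(K)$, $\partial_0b_i=\partial_1b_{i+1}$;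 $\partial_1p=\partial_1b_1$, $\partial_0p=\partial_0b_n$. $K$ is pathwise connected if any two elements are joined by a path. Homotopy of paths is the equivalence relation generated by replacing, anywhere in a path, $\partial_1c$ by $\partial_0c*\partial_2c$, $c\in\tilde\Sigma_2(K)$. $\pi_1(K)=\pi_1(K,a)$ is the group of homotopy classes of loops at a fixed $a\in K$ under concatenation. Principal net bundle $\mathcal{P}$ over $K$ with structure group $G$: a set $P$, a surjection $\pi:P\to K$, bijections $J_b:\pi^{-1}(\partial_1b)\to\pi^{-1}(\partial_0b)$ for $b\in\Sigma_1(K)$ with $J_{\partial_0c}J_{\partial_2c}=J_{\partial_1c}$ ($c\in\Sigma_2(K)$) and $J_{\sigma_0a}=\mathrm{id}$, and a free right action of $G$ on $P$ preserving the fibres, transitive on each fibre, with $J_b(\psi\cdot g)=J_b(\psi)\cdot g$. A morphism $\hat{\mathcal{P}}\to\mathcal{P}$ is a $G$-equivariant map $f:\hat P\to P$ with $\pi f=\hat\pi$ and $Jf=f\hat J$. Connection on $\mathcal{P}$: a family of $G$-equivariant bijections $U(b):\pi^{-1}(\partial_1b)\to\pi^{-1}(\partial_0b)$, $b\in\tilde\Sigma_1(K)$, with $U(\overline b)=U(b)^{-1}$ and $U(b)=J_b$ for $b\in\Sigma_1(K)$. It is flat if $U(\partial_0c)U(\partial_2c)=U(\partial_1c)$ for all $c\in\tilde\Sigma_2(K)$. Connections $\hat U$ on $\hat{\mathcal{P}}$ and $U$ on $\mathcal{P}$ are equivalent if there is a morphism $f:\hat{\mathcal{P}}\to\mathcal{P}$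 with $f\hat U(b)=U(b)f$ for all $b$ (all such $f$ are invertible). Two homomorphisms $\pi_1(K)\to G$ are equivalent if they differ by an inner automorphism of $G$. *)

theory Defs
  imports "HOL-Algebra.Group"
begin

section \<open>Simplices of a poset\<close>

text \<open>
  The poset is the universe of a type of class \<^class>\<open>order\<close>.
  An order-preserving map \<open>s\<close> from the non-empty subsets of \<open>{0,1}\<close> is recorded as
  \<open>Simplex1 (s{0,1}) (s{1}) (s{0})\<close>; one from the non-empty subsets of \<open>{0,1,2}\<close> is recorded by
  its support \<open>s{0,1,2}\<close> and its restrictions to the faces \<open>{1,2}\<close>, \<open>{0,2}\<close>, \<open>{0,1}\<close>
  opposite to \<open>0\<close>, \<open>1\<close>, \<open>2\<close>.
\<close>

datatype 'k simplex1 = Simplex1 (supp1: 'k) (face0: 'k) (face1: 'k)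

datatype 'k simplex2 =
  Simplex2 (supp2: 'k) (bd0: "'k simplex1") (bd1: "'k simplex1") (bd2: "'k simplex1")

definition simplices1 :: "'k::order simplex1 set" where
  "simplices1 = {b. face0 b \<le> supp1 b \<and> face1 b \<le> supp1 b}"

definition simplices2 :: "'k::order simplex2 set" where
  "simplices2 = {c.
     bd0 c \<in> simplices1 \<and> bd1 c \<in> simplices1 \<and> bd2 c \<in> simplices1 \<and>
     supp1 (bd0 c) \<le> supp2 c \<and> supp1 (bd1 c) \<le> supp2 c \<and> supp1 (bd2 c) \<le> supp2 c \<and>
     face0 (bd0 c) = face0 (bd1 c) \<and>
     face1 (bd0 c) = face0 (bd2 c) \<and>
     face1 (bd1 c) = face1 (bd2 c)}"

definition reverse1 :: "'k simplex1 \<Rightarrow> 'k simplex1" where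
  "reverse1 b = Simplex1 (supp1 b) (face1 b) (face0 b)"

definition degenerate1 :: "'k \<Rightarrow> 'k simplex1" where
  "degenerate1 a = Simplex1 a a a"

definition nerve1 :: "'k::order simplex1 set" where
  "nerve1 = {Simplex1 v v w |v w. w \<le> v}"

definition nerve2 :: "'k::order simplex2 set" where
  "nerve2 = {Simplex2 v2 (Simplex1 v2 v2 v1) (Simplex1 v2 v2 v0) (Simplex1 v1 v1 v0) |v0 v1 v2.
     v0 \<le> v1 \<and> v1 \<le> v2}"


section \<open>Paths and the fundamental group\<close>

text \<open>
  The path \<open>b\<^sub>n * \<dots> * b\<^sub>1\<close> is the list \<open>[b\<^sub>n, \<dots>, b\<^sub>1]\<close>, in this order, so that \<open>p * q\<close>
  (first \<open>q\<close>, then \<open>p\<close>) is \<open>p @ q\<close>. Paths have at least one edge.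
\<close>

definition is_path :: "'k::order simplex1 list \<Rightarrow> bool" where
  "is_path p \<longleftrightarrow> p \<noteq> [] \<and> set p \<subseteq> simplices1 \<and> successively (\<lambda>b' b. face1 b' = face0 b) p"

definition path_end :: "'k simplex1 list \<Rightarrow> 'k" where
  "path_end p = face0 (hd p)"

definition path_start :: "'k simplex1 list \<Rightarrow> 'k" where
  "path_start p = face1 (last p)"

definition pathwise_connected :: "'k::order itself \<Rightarrow> bool" where
  "pathwise_connected _ \<longleftrightarrow>
     (\<forall>x y :: 'k. \<exists>p. is_path p \<and> path_start p = x \<and> path_end p = y)"

definition elementary_deformation :: "'k::order simplex1 list \<Rightarrow> 'k simplex1 list \<Rightarrow> bool" where
  "elementary_deformation p q \<longleftrightarrow> is_path p \<and> is_path q \<and>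
     (\<exists>u v. \<exists>c\<in>simplices2. p = u @ [bd1 c] @ v \<and> q = u @ [bd0 c, bd2 c] @ v)"

definition path_homotopic :: "'k::order simplex1 list \<Rightarrow> 'k simplex1 list \<Rightarrow> bool" where
  "path_homotopic = equivclp elementary_deformation"

definition loops :: "'k::order \<Rightarrow> 'k simplex1 list set" where
  "loops a = {p. is_path p \<and> path_start p = a \<and> path_end p = a}"

definition loop_homotopy :: "'k::order \<Rightarrow> ('k simplex1 list \<times> 'k simplex1 list) set" where
  "loop_homotopy a = {(p, q). p \<in> loops a \<and> q \<in> loops a \<and> path_homotopic p q}"

definition fundamental_group :: "'k::order \<Rightarrow> 'k simplex1 list set monoid" where
  "fundamental_group a =
     \<lparr>carrier = loops a // loop_homotopy a,
      monoid.mult = (\<lambda>X Y. \<Union>p\<in>X. \<Union>q\<in>Y. loop_homotopy a `` {p @ q}),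
      one = loop_homotopy a `` {[degenerate1 a]}\<rparr>"


section \<open>Principal net bundles\<close>

text \<open>
  \<open>act B \<psi> g\<close> is the right action \<open>\<psi> \<cdot> g\<close> and \<open>net B b\<close> is \<open>J\<^sub>b\<close>. As in HOL-Algebra, operations
  are total functions that matter only on the relevant carriers; values elsewhere are arbitrary,
  and data differing only there are identified by the equivalence of connections below.
\<close>

record ('k, 'g, 'p) net_bundle =
  total :: "'p set"
  proj :: "'p \<Rightarrow> 'k"
  net :: "'k simplex1 \<Rightarrow> 'p \<Rightarrow> 'p"
  act :: "'p \<Rightarrow> 'g \<Rightarrow> 'p"

definition fibre :: "('k, 'g, 'p) net_bundle \<Rightarrow> 'k \<Rightarrow> 'p set" where
  "fibre B x = {\<psi> \<in> total B. proj B \<psi> = x}"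

locale principal_net_bundle = group G
  for G :: "('g, 'm) monoid_scheme" (structure) and B :: "('k::order, 'g, 'p) net_bundle" +
  assumes proj_surj: "proj B ` total B = UNIV"
    and net_bij: "b \<in> nerve1 \<Longrightarrow> bij_betw (net B b) (fibre B (face1 b)) (fibre B (face0 b))"
    and net_cocycle: "\<lbrakk>c \<in> nerve2; \<psi> \<in> fibre B (face1 (bd2 c))\<rbrakk> \<Longrightarrow>
          net B (bd0 c) (net B (bd2 c) \<psi>) = net B (bd1 c) \<psi>"
    and net_degenerate: "\<psi> \<in> fibre B x \<Longrightarrow> net B (degenerate1 x) \<psi> = \<psi>"
    and act_closed: "\<lbrakk>\<psi> \<in> total B; g \<in> carrier G\<rbrakk> \<Longrightarrow> act B \<psi> g \<in> total B"
    and act_one: "\<psi> \<in> total B \<Longrightarrow> act B \<psi> \<one> = \<psi>"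
    and act_mult: "\<lbrakk>\<psi> \<in> total B; g \<in> carrier G; h \<in> carrier G\<rbrakk> \<Longrightarrow>
          act B \<psi> (g \<otimes> h) = act B (act B \<psi> g) h"
    and act_free: "\<lbrakk>\<psi> \<in> total B; g \<in> carrier G; act B \<psi> g = \<psi>\<rbrakk> \<Longrightarrow> g = \<one>"
    and act_fibre: "\<lbrakk>\<psi> \<in> total B; g \<in> carrier G\<rbrakk> \<Longrightarrow> proj B (act B \<psi> g) = proj B \<psi>"
    and act_transitive: "\<lbrakk>\<psi> \<in> fibre B x; \<phi> \<in> fibre B x\<rbrakk> \<Longrightarrow> \<exists>g\<in>carrier G. \<phi> = act B \<psi> g"
    and net_equivariant: "\<lbrakk>b \<in> nerve1; \<psi> \<in> fibre B (face1 b); g \<in> carrier G\<rbrakk> \<Longrightarrow>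
          net B b (act B \<psi> g) = act B (net B b \<psi>) g"

definition bundle_morphism ::
  "('g, 'm) monoid_scheme \<Rightarrow> ('k::order, 'g, 'p) net_bundle \<Rightarrow> ('k, 'g, 'q) net_bundle \<Rightarrow>
   ('p \<Rightarrow> 'q) \<Rightarrow> bool" where
  "bundle_morphism G B' B f \<longleftrightarrow>
     (\<forall>\<psi>\<in>total B'. f \<psi> \<in> total B \<and> proj B (f \<psi>) = proj B' \<psi>) \<and>
     (\<forall>\<psi>\<in>total B'. \<forall>g\<in>carrier G. f (act B' \<psi> g) = act B (f \<psi>) g) \<and>
     (\<forall>b\<in>nerve1. \<forall>\<psi>\<in>fibre B' (face1 b). net B b (f \<psi>) = f (net B' b \<psi>))"


section \<open>Flat connections and their equivalence\<close>

locale net_connection = principal_net_bundle G B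
  for G :: "('g, 'm) monoid_scheme" (structure) and B :: "('k::order, 'g, 'p) net_bundle" +
  fixes U :: "'k simplex1 \<Rightarrow> 'p \<Rightarrow> 'p"
  assumes conn_bij: "b \<in> simplices1 \<Longrightarrow> bij_betw (U b) (fibre B (face1 b)) (fibre B (face0 b))"
    and conn_equivariant: "\<lbrakk>b \<in> simplices1; \<psi> \<in> fibre B (face1 b); g \<in> carrier G\<rbrakk> \<Longrightarrow>
          U b (act B \<psi> g) = act B (U b \<psi>) g"
    and conn_reverse: "\<lbrakk>b \<in> simplices1; \<psi> \<in> fibre B (face0 b)\<rbrakk> \<Longrightarrow>
          U (reverse1 b) \<psi> = inv_into (fibre B (face1 b)) (U b) \<psi>"
    and conn_nerve: "\<lbrakk>b \<in> nerve1; \<psi> \<in> fibre B (face1 b)\<rbrakk> \<Longrightarrow> U b \<psi> = net B b \<psi>"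

locale flat_net_connection = net_connection +
  assumes flat: "\<lbrakk>c \<in> simplices2; \<psi> \<in> fibre B (face1 (bd2 c))\<rbrakk> \<Longrightarrow>
          U (bd0 c) (U (bd2 c) \<psi>) = U (bd1 c) \<psi>"

type_synonym ('k, 'g, 'p) bundle_connection =
  "('k, 'g, 'p) net_bundle \<times> ('k simplex1 \<Rightarrow> 'p \<Rightarrow> 'p)"

text \<open>
  Flat connections on all principal net bundles whose total space is a set of elements of
  type \<open>'p\<close>.
\<close>

definition flat_connections ::
  "('g, 'm) monoid_scheme \<Rightarrow> ('k::order, 'g, 'p) bundle_connection set" where
  "flat_connections G = {(B, U). flat_net_connection G B U}"

text \<open>
  The two total spaces may live in different types, so that bundles can be compared across
  universes.
\<close>

definition connections_equivalent ::
  "('g, 'm) monoid_scheme \<Rightarrow> ('k::order, 'g, 'p) bundle_connection \<Rightarrow>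
   ('k, 'g, 'q) bundle_connection \<Rightarrow> bool" where
  "connections_equivalent G C' C \<longleftrightarrow>
     (\<exists>f. bundle_morphism G (fst C') (fst C) f \<and>
          (\<forall>b\<in>simplices1. \<forall>\<psi>\<in>fibre (fst C') (face1 b). f (snd C' b \<psi>) = snd C b (f \<psi>)))"

definition flat_connection_equiv ::
  "('g, 'm) monoid_scheme \<Rightarrow>
   (('k::order, 'g, 'p) bundle_connection \<times> ('k, 'g, 'p) bundle_connection) set" where
  "flat_connection_equiv G =
     {(C', C). C' \<in> flat_connections G \<and> C \<in> flat_connections G \<and> connections_equivalent G C' C}"


section \<open>Equivalence of homomorphisms\<close>

text \<open>
  \<open>hom H G\<close> does not constrain functions outside \<open>carrier H\<close>; functions agreeing on
  \<open>carrier H\<close> are equivalent here (take \<open>g = \<one>\<close>).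
\<close>

definition hom_equiv ::
  "('h, 'n) monoid_scheme \<Rightarrow> ('g, 'm) monoid_scheme \<Rightarrow> (('h \<Rightarrow> 'g) \<times> ('h \<Rightarrow> 'g)) set" where
  "hom_equiv H G = {(\<chi>', \<chi>). \<chi>' \<in> hom H G \<and> \<chi> \<in> hom H G \<and>
     (\<exists>g\<in>carrier G. \<forall>x\<in>carrier H. \<chi>' x = g \<otimes>\<^bsub>G\<^esub> \<chi> x \<otimes>\<^bsub>G\<^esub> inv\<^bsub>G\<^esub> g)}"

end

theory Submission
  imports Defs
begin

text \<open>
  Flatness makes parallel transport invariant under homotopy, so transporting a point \<open>\<psi>\<close> of the
  fibre over \<open>a\<close> around loops defines a homomorphism \<open>\<chi>\<close> with \<open>U(p) \<psi> = \<psi> \<cdot> \<chi>[p]\<close>; replacing \<open>\<psi>\<close>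
  by \<open>\<psi> \<cdot> g\<close>, or the connection by an equivalent one, conjugates \<open>\<chi>\<close>. Conversely, connections with
  the same holonomy are intertwined by the map that matches the transports of the two base points
  along each path, and every homomorphism is the holonomy of a flat connection on the product
  \<open>K \<times> G\<close>, where a 1-simplex acts by the value of the homomorphism on the loop that it closes up
  to by chosen paths from \<open>a\<close>.
\<close>

section \<open>Paths and homotopy\<close>

definition paths :: "'k::order \<Rightarrow> 'k \<Rightarrow> 'k simplex1 list set" where
  "paths x y = {p. is_path p \<and> path_start p = x \<and> path_end p = y}"

definition rev_path :: "'k simplex1 list \<Rightarrow> 'k simplex1 list" where
  "rev_path p = rev (map reverse1 p)"

lemma loops_eq_paths: "loops a = paths a a"
  by (simp add: loops_def paths_def)

lemma simplex1_reverse [simp]: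
  "face0 (reverse1 b) = face1 b" "face1 (reverse1 b) = face0 b"
  "supp1 (reverse1 b) = supp1 b" "reverse1 (reverse1 b) = b"
  by (simp_all add: reverse1_def)

lemma simplex1_degenerate [simp]:
  "face0 (degenerate1 x) = x" "face1 (degenerate1 x) = x" "supp1 (degenerate1 x) = x"
  by (simp_all add: degenerate1_def)

lemma reverse1_in_simplices1 [simp]: "reverse1 b \<in> simplices1 \<longleftrightarrow> b \<in> simplices1"
  by (auto simp: simplices1_def)

lemma degenerate1_in_simplices1 [simp]: "degenerate1 x \<in> simplices1"
  by (simp add: simplices1_def)

lemma nerve1_subset_simplices1: "nerve1 \<subseteq> simplices1"
  by (auto simp: nerve1_def simplices1_def)

lemma nerve2_subset_simplices2: "nerve2 \<subseteq> simplices2"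
  by (auto simp: nerve2_def simplices2_def simplices1_def)

lemma simplices2_bd:
  assumes "c \<in> simplices2"
  shows "bd0 c \<in> simplices1" "bd1 c \<in> simplices1" "bd2 c \<in> simplices1"
    "face0 (bd0 c) = face0 (bd1 c)" "face1 (bd0 c) = face0 (bd2 c)" "face1 (bd1 c) = face1 (bd2 c)"
  using assms by (auto simp: simplices2_def)

lemma paths_singleton: "b \<in> simplices1 \<Longrightarrow> [b] \<in> paths (face1 b) (face0 b)"
  by (simp add: paths_def is_path_def path_start_def path_end_def)

lemma degenerate_path: "[degenerate1 x] \<in> paths x x"
  using paths_singleton[of "degenerate1 x"] by simp

lemma paths_append:
  assumes "p \<in> paths y z" "q \<in> paths x y"
  shows "p @ q \<in> paths x z"
  using assms
  by (auto simp: paths_def is_path_def path_start_def path_end_def successively_append_iff)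

lemma paths_appendE:
  assumes "p @ q \<in> paths x z" "p \<noteq> []" "q \<noteq> []"
  obtains y where "p \<in> paths y z" "q \<in> paths x y"
  using assms
  by (auto simp: paths_def is_path_def path_start_def path_end_def successively_append_iff)

lemma paths_Cons:
  assumes "b \<in> simplices1" "p \<in> paths x (face1 b)"
  shows "b # p \<in> paths x (face0 b)"
  using paths_append[OF paths_singleton[OF assms(1)] assms(2)] by simp

text \<open>The head of the list is the edge travelled last, so the induction extends a path at its
  end, in the order in which parallel transport is computed. It starts from a single edge since no
  path is empty.\<close>

lemma paths_induct [consumes 1, case_names single Cons]:
  assumes "p \<in> paths x y"
    and "\<And>b. b \<in> simplices1 \<Longrightarrow> P (face1 b) (face0 b) [b]"
    and "\<And>b p x. \<lbrakk>b \<in> simplices1; p \<in> paths x (face1 b); P x (face1 b) p\<rbrakk> \<Longrightarrow> P x (face0 b) (b # p)"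
  shows "P x y p"
  using assms(1)
proof (induction p arbitrary: y)
  case Nil
  then show ?case by (simp add: paths_def is_path_def)
next
  case (Cons b p)
  have b: "b \<in> simplices1" and y: "y = face0 b"
    using Cons.prems by (auto simp: paths_def is_path_def path_end_def)
  show ?case
  proof (cases "p = []")
    case True
    with Cons.prems have "x = face1 b" by (simp add: paths_def path_start_def)
    with True assms(2)[OF b] y show ?thesis by simp
  next
    case False
    with Cons.prems have "p \<in> paths x (face1 b)"
      by (auto simp: paths_def is_path_def path_start_def path_end_def successively_Cons)
    with Cons.IH assms(3)[OF b] y show ?thesis by simp
  qed
qed

lemma rev_path_simps [simp]:
  "rev_path [] = []" "rev_path (b # p) = rev_path p @ [reverse1 b]"
  "rev_path (p @ q) = rev_path q @ rev_path p" "rev_path (rev_path p) = p"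
  by (simp_all add: rev_path_def rev_map comp_def)

lemma rev_path_in_paths: "p \<in> paths x y \<Longrightarrow> rev_path p \<in> paths y x"
proof (induction rule: paths_induct)
  case (single b)
  then show ?case using paths_singleton[of "reverse1 b"] by simp
next
  case (Cons b p x)
  then show ?case using paths_append[OF Cons.IH, of "[reverse1 b]"] paths_singleton[of "reverse1 b"]
    by simp
qed

section \<open>Homotopy of paths with fixed ends\<close>

lemma elementary_deformation_in_paths:
  assumes "elementary_deformation p q"
  shows "p \<in> paths x y \<longleftrightarrow> q \<in> paths x y"
  using assms
  by (auto simp: elementary_deformation_def paths_def path_start_def path_end_def
      simplices2_bd hd_append last_append)

lemma path_homotopic_refl [simp]: "path_homotopic p p"
  by (simp add: path_homotopic_def)

lemma path_homotopic_sym: "path_homotopic p q \<Longrightarrow> path_homotopic q p"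
  unfolding path_homotopic_def by (rule equivclp_sym)

lemma path_homotopic_trans [trans]:
  "path_homotopic p q \<Longrightarrow> path_homotopic q r \<Longrightarrow> path_homotopic p r"
  unfolding path_homotopic_def by (rule equivclp_trans)

lemma elementary_deformation_homotopic: "elementary_deformation p q \<Longrightarrow> path_homotopic p q"
  unfolding path_homotopic_def by (rule r_into_equivclp)

text \<open>Each link of an \<open>equivclp\<close> chain is a deformation read in either direction,
  hence the disjunction in \<open>euclid\<close>. The ends are carried along so that
  \<open>step\<close> only concerns paths from \<open>x\<close> to \<open>y\<close>.\<close>

lemma path_homotopic_induct [consumes 2, case_names refl sym_trans step]:
  assumes "path_homotopic p q" "p \<in> paths x y"
    and refl: "\<And>p. p \<in> paths x y \<Longrightarrow> R p p"
    and euclid: "\<And>p q r. \<lbrakk>R p q; R r q \<or> R q r\<rbrakk> \<Longrightarrow> R p r"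
    and step: "\<And>p q. \<lbrakk>elementary_deformation p q; p \<in> paths x y; q \<in> paths x y\<rbrakk> \<Longrightarrow> R p q"
  shows "q \<in> paths x y \<and> R p q"
  using assms(1) unfolding path_homotopic_def
proof (induction rule: equivclp_induct)
  case base
  then show ?case using assms(2) refl by simp
next
  case (step q r)
  then show ?case
    using elementary_deformation_in_paths assms(5) euclid by blast
qed

lemma path_homotopic_in_paths:
  "\<lbrakk>path_homotopic p q; p \<in> paths x y\<rbrakk> \<Longrightarrow> q \<in> paths x y"
  using path_homotopic_induct[where R = "\<lambda>_ _. True"] by blast

text \<open>Deform one factor at a time: a deformation inside a factor is a deformation of the whole
  path, with the other factor added to the surrounding context.\<close>

lemma path_homotopic_append:
  assumes p: "path_homotopic p p'" "p \<in> paths y z" and q: "path_homotopic q q'" "q \<in> paths x y"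
  shows "path_homotopic (p @ q) (p' @ q')"
proof -
  have "path_homotopic (p @ q) (p' @ q)"
  proof -
    have "p' \<in> paths y z \<and> path_homotopic (p @ q) (p' @ q)"
      using p
    proof (induction rule: path_homotopic_induct)
      case (step r s)
      then have "r @ q \<in> paths x z" "s @ q \<in> paths x z"
        using paths_append q(2) by blast+
      with step have "elementary_deformation (r @ q) (s @ q)"
        unfolding elementary_deformation_def paths_def by auto (metis append.assoc append_Cons)
      then show ?case by (rule elementary_deformation_homotopic)
    qed (auto intro: path_homotopic_trans path_homotopic_sym)
    then show ?thesis by simp
  qed
  moreover have "path_homotopic (p' @ q) (p' @ q')"
  proof -
    have p': "p' \<in> paths y z" using path_homotopic_in_paths[OF p] .
    have "q' \<in> paths x y \<and> path_homotopic (p' @ q) (p' @ q')"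
      using q
    proof (induction rule: path_homotopic_induct)
      case (step r s)
      then have "p' @ r \<in> paths x z" "p' @ s \<in> paths x z"
        using paths_append p' by blast+
      with step have "elementary_deformation (p' @ r) (p' @ s)"
        unfolding elementary_deformation_def paths_def by auto (metis append.assoc)
      then show ?case by (rule elementary_deformation_homotopic)
    qed (auto intro: path_homotopic_trans path_homotopic_sym)
    then show ?thesis by simp
  qed
  ultimately show ?thesis by (rule path_homotopic_trans)
qed

section \<open>Groupoid laws up to homotopy\<close>

lemma simplex2_homotopic:
  assumes "c \<in> simplices2"
  shows "path_homotopic [bd0 c, bd2 c] [bd1 c]"
proof -
  have "is_path [bd1 c]" "is_path [bd0 c, bd2 c]"
    using assms by (simp_all add: is_path_def simplices2_bd)
  then have "elementary_deformation [bd1 c] [bd0 c, bd2 c]"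
    unfolding elementary_deformation_def using assms by (metis append_Nil append_Nil2)
  then show ?thesis using elementary_deformation_homotopic path_homotopic_sym by blast
qed

text \<open>Only the last edge \<open>b\<close> matters: the 2-simplex with the support of
  \<open>b\<close> and faces \<open>degenerate1 (face0 b)\<close>, \<open>b\<close>,
  \<open>b\<close> absorbs the constant edge.\<close>

lemma degenerate_append_homotopic:
  assumes "p \<in> paths x y"
  shows "path_homotopic ([degenerate1 y] @ p) p"
  using assms
proof (induction rule: paths_induct)
  case (single b)
  then have "Simplex2 (supp1 b) (degenerate1 (face0 b)) b b \<in> simplices2"
    by (auto simp: simplices2_def simplices1_def)
  from simplex2_homotopic[OF this] show ?case by simp
next
  case (Cons b p x)
  then have "Simplex2 (supp1 b) (degenerate1 (face0 b)) b b \<in> simplices2"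
    by (auto simp: simplices2_def simplices1_def)
  then have "path_homotopic [degenerate1 (face0 b), b] [b]"
    using simplex2_homotopic by fastforce
  moreover have "[degenerate1 (face0 b), b] \<in> paths (face1 b) (face0 b)"
    using paths_append[OF degenerate_path paths_singleton[OF Cons.hyps(1)]] by simp
  ultimately show ?case
    using path_homotopic_append[OF _ _ path_homotopic_refl Cons.hyps(2)] by fastforce
qed

text \<open>Cancellation runs from the middle outwards: \<open>b\<close> followed by
  \<open>reverse1 b\<close> spans a 2-simplex whose long edge \<open>bd1\<close> is degenerate, that
  edge is absorbed into \<open>p\<close>, and the shorter word cancels by induction.\<close>

lemma rev_path_append_homotopic:
  assumes "p \<in> paths x y"
  shows "path_homotopic (rev_path p @ p) [degenerate1 x]"
  using assms
proof (induction rule: paths_induct)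
  case (single b)
  then have "Simplex2 (supp1 b) (reverse1 b) (degenerate1 (face1 b)) b \<in> simplices2"
    by (auto simp: simplices2_def simplices1_def)
  from simplex2_homotopic[OF this] show ?case by simp
next
  case (Cons b p x)
  then have "Simplex2 (supp1 b) (reverse1 b) (degenerate1 (face1 b)) b \<in> simplices2"
    by (auto simp: simplices2_def simplices1_def)
  then have h: "path_homotopic [reverse1 b, b] [degenerate1 (face1 b)]"
    using simplex2_homotopic by fastforce
  have bb: "[reverse1 b, b] \<in> paths (face1 b) (face1 b)"
    using paths_append[of "[reverse1 b]" _ _ "[b]"] paths_singleton[of "reverse1 b"]
      paths_singleton[of b] Cons.hyps(1) by fastforce
  have "path_homotopic ([reverse1 b, b] @ p) ([degenerate1 (face1 b)] @ p)"
    using path_homotopic_append[OF h bb path_homotopic_refl Cons.hyps(2)] .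
  also have "path_homotopic \<dots> p"
    using degenerate_append_homotopic[OF Cons.hyps(2)] .
  finally have "path_homotopic ([reverse1 b, b] @ p) p" .
  then have "path_homotopic (rev_path p @ ([reverse1 b, b] @ p)) (rev_path p @ p)"
    using path_homotopic_append[OF path_homotopic_refl rev_path_in_paths[OF Cons.hyps(2)]]
      paths_append[OF bb Cons.hyps(2)] by blast
  also note Cons.IH
  finally show ?case by simp
qed

lemma append_rev_path_homotopic:
  assumes "p \<in> paths x y"
  shows "path_homotopic (p @ rev_path p) [degenerate1 y]"
  using rev_path_append_homotopic[OF rev_path_in_paths[OF assms]] by simp

text \<open>Needed when paths closed up to loops are multiplied: the two copies of the auxiliary
  path to the common vertex \<open>y\<close> cancel.\<close>

lemma cancel_rev_path_homotopic:
  assumes p: "p \<in> paths y z" and r: "r \<in> paths w y" and q: "q \<in> paths x y"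
  shows "path_homotopic (p @ r @ rev_path r @ q) (p @ q)"
proof -
  have rr: "r @ rev_path r \<in> paths y y"
    using paths_append[OF r rev_path_in_paths[OF r]] .
  have "path_homotopic ((r @ rev_path r) @ q) ([degenerate1 y] @ q)"
    using path_homotopic_append[OF append_rev_path_homotopic[OF r] rr path_homotopic_refl q] .
  also have "path_homotopic \<dots> q"
    using degenerate_append_homotopic[OF q] .
  finally show ?thesis
    using path_homotopic_append[OF path_homotopic_refl p _ paths_append[OF rr q]] by simp
qed


section \<open>The fundamental group\<close>

definition loop_class :: "'k::order \<Rightarrow> 'k simplex1 list \<Rightarrow> 'k simplex1 list set" where
  "loop_class a p = loop_homotopy a `` {p}"

lemma equiv_loop_homotopy: "equiv (loops a) (loop_homotopy a)"
  by (rule equivI)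
    (auto simp: loop_homotopy_def refl_on_def sym_def trans_def
      intro: path_homotopic_sym path_homotopic_trans)

lemma loop_class_eq_iff:
  assumes "p \<in> paths a a" "q \<in> paths a a"
  shows "loop_class a p = loop_class a q \<longleftrightarrow> path_homotopic p q"
  using eq_equiv_class_iff[OF equiv_loop_homotopy] assms
  by (auto simp: loop_class_def loop_homotopy_def loops_eq_paths)

lemma carrier_fundamental_group: "carrier (fundamental_group a) = loop_class a ` paths a a"
  by (auto simp: fundamental_group_def quotient_def loop_class_def loops_eq_paths)

text \<open>Since homotopy respects concatenation, all terms of the double union defining the
  product are the same class.\<close>

lemma loop_class_mult:
  assumes p: "p \<in> paths a a" and q: "q \<in> paths a a"
  shows "loop_class a p \<otimes>\<^bsub>fundamental_group a\<^esub> loop_class a q = loop_class a (p @ q)"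
proof -
  have "loop_homotopy a `` {p' @ q'} = loop_class a (p @ q)"
    if "p' \<in> loop_class a p" "q' \<in> loop_class a q" for p' q'
  proof -
    from that have h: "path_homotopic p p'" "path_homotopic q q'"
      and l: "p' \<in> paths a a" "q' \<in> paths a a"
      by (auto simp: loop_class_def loop_homotopy_def loops_eq_paths)
    then have "path_homotopic (p @ q) (p' @ q')"
      using path_homotopic_append p q by blast
    then have "loop_class a (p @ q) = loop_class a (p' @ q')"
      using loop_class_eq_iff paths_append p q l by blast
    then show ?thesis by (simp add: loop_class_def)
  qed
  \<comment> \<open>The index sets of the union are non-empty; otherwise the union would be empty
    instead of the common class.\<close>
  moreover have "p \<in> loop_class a p" "q \<in> loop_class a q"
    using p q by (auto simp: loop_class_def loop_homotopy_def loops_eq_paths)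
  ultimately show ?thesis
    by (auto simp: fundamental_group_def)
qed


section \<open>Holonomy\<close>

text \<open>Path composition runs right to left, so \<open>foldr\<close> applies the first edge of the path first.\<close>

definition transport :: "('k simplex1 \<Rightarrow> 'p \<Rightarrow> 'p) \<Rightarrow> 'k simplex1 list \<Rightarrow> 'p \<Rightarrow> 'p" where
  "transport U p = foldr U p"

lemma transport_simps [simp]:
  "transport U [] \<psi> = \<psi>" "transport U (b # p) \<psi> = U b (transport U p \<psi>)"
  "transport U (p @ q) \<psi> = transport U p (transport U q \<psi>)"
  by (simp_all add: transport_def)

section \<open>Fibres as torsors under the structure group\<close>

context principal_net_bundle
begin

lemma fibre_nonempty: "\<exists>\<psi>. \<psi> \<in> fibre B x"
  using proj_surj unfolding fibre_def by (metis (mono_tags) UNIV_I imageE mem_Collect_eq)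

lemma act_in_fibre: "\<lbrakk>\<psi> \<in> fibre B x; g \<in> carrier G\<rbrakk> \<Longrightarrow> act B \<psi> g \<in> fibre B x"
  by (simp add: fibre_def act_closed act_fibre)

lemma act_act: "\<lbrakk>\<psi> \<in> fibre B x; g \<in> carrier G; h \<in> carrier G\<rbrakk> \<Longrightarrow>
    act B (act B \<psi> g) h = act B \<psi> (g \<otimes> h)"
  by (simp add: fibre_def act_mult)

text \<open>Freeness speaks of stabilisers only: equal images under \<open>g\<close> and
  \<open>h\<close> make \<open>g \<otimes> inv h\<close> fix \<open>\<psi>\<close>.\<close>

lemma act_cancel:
  assumes \<psi>: "\<psi> \<in> fibre B x" and g: "g \<in> carrier G" and h: "h \<in> carrier G"
    and eq: "act B \<psi> g = act B \<psi> h"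
  shows "g = h"
proof -
  have "act B \<psi> (g \<otimes> inv h) = act B (act B \<psi> h) (inv h)"
    using act_act[OF \<psi>, of g "inv h"] g h eq by simp
  also have "\<dots> = \<psi>"
    using act_act[OF \<psi>, of h "inv h"] h \<psi> by (simp add: fibre_def act_one)
  finally have "g \<otimes> inv h = \<one>"
    using act_free[of \<psi> "g \<otimes> inv h"] \<psi> g h by (simp add: fibre_def)
  then show ?thesis
    using g h by (metis inv_equality inv_closed inv_inv)
qed

end

text \<open>The base point is an argument: for fixed \<open>\<psi>\<close> freeness determines a
  \<open>G\<close>-valued \<open>\<chi>\<close> on the classes of loops, while moving
  \<open>\<psi>\<close> in its fibre conjugates it.\<close>

definition holonomy_at ::
  "('k::order, 'g, 'p) bundle_connection \<Rightarrow> 'k \<Rightarrow> 'p \<Rightarrow> ('k simplex1 list set \<Rightarrow> 'g) \<Rightarrow> bool" where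
  "holonomy_at C a \<psi> \<chi> \<longleftrightarrow> \<psi> \<in> fibre (fst C) a \<and>
     (\<forall>p\<in>paths a a. transport (snd C) p \<psi> = act (fst C) \<psi> (\<chi> (loop_class a p)))"

lemma hom_loop_class:
  assumes "\<chi> \<in> hom (fundamental_group a) G" "p \<in> paths a a"
  shows "\<chi> (loop_class a p) \<in> carrier G"
  using assms by (auto simp: hom_def carrier_fundamental_group)

lemma hom_loop_class_append:
  assumes "\<chi> \<in> hom (fundamental_group a) G" "p \<in> paths a a" "q \<in> paths a a"
  shows "\<chi> (loop_class a (p @ q)) = \<chi> (loop_class a p) \<otimes>\<^bsub>G\<^esub> \<chi> (loop_class a q)"
  using assms by (auto simp: hom_def carrier_fundamental_group simp flip: loop_class_mult)

context flat_net_connection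
begin

lemma conn_in_fibre:
  "\<lbrakk>b \<in> simplices1; \<psi> \<in> fibre B (face1 b)\<rbrakk> \<Longrightarrow> U b \<psi> \<in> fibre B (face0 b)"
  using conn_bij bij_betwE by blast

lemma transport_in_fibre:
  "\<lbrakk>p \<in> paths x y; \<psi> \<in> fibre B x\<rbrakk> \<Longrightarrow> transport U p \<psi> \<in> fibre B y"
  by (induction rule: paths_induct) (simp_all add: conn_in_fibre)

lemma transport_equivariant:
  "\<lbrakk>p \<in> paths x y; \<psi> \<in> fibre B x; g \<in> carrier G\<rbrakk> \<Longrightarrow>
    transport U p (act B \<psi> g) = act B (transport U p \<psi>) g"
  by (induction rule: paths_induct) (simp_all add: conn_equivariant transport_in_fibre)

lemma conn_reverse_cancel:
  "\<lbrakk>b \<in> simplices1; \<psi> \<in> fibre B (face1 b)\<rbrakk> \<Longrightarrow> U (reverse1 b) (U b \<psi>) = \<psi>"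
  by (simp add: conn_reverse conn_in_fibre inv_into_f_f[OF bij_betw_imp_inj_on[OF conn_bij]])

lemma transport_rev_path:
  "\<lbrakk>p \<in> paths x y; \<psi> \<in> fibre B x\<rbrakk> \<Longrightarrow> transport U (rev_path p) (transport U p \<psi>) = \<psi>"
  by (induction rule: paths_induct) (simp_all add: conn_reverse_cancel transport_in_fibre)

text \<open>Flatness is invariance under replacing an edge of a single 2-simplex; what precedes and
  follows it in the path is transported alike on both sides.\<close>

lemma transport_homotopic:
  assumes "path_homotopic p q" "p \<in> paths x y" and \<psi>: "\<psi> \<in> fibre B x"
  shows "transport U p \<psi> = transport U q \<psi>"
proof -
  have "q \<in> paths x y \<and> transport U p \<psi> = transport U q \<psi>"
    using assms(1,2)
  proof (induction rule: path_homotopic_induct)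
    case (step p q)
    then obtain u v c where c: "c \<in> simplices2"
      and p: "p = u @ [bd1 c] @ v" and q: "q = u @ [bd0 c, bd2 c] @ v"
      unfolding elementary_deformation_def by blast
    \<comment> \<open>\<open>flat\<close> speaks of points over the initial vertex of
      \<open>c\<close>. If \<open>v\<close> is empty, the point is \<open>\<psi>\<close> itself and
      \<open>c\<close> begins where the whole path does.\<close>
    have "transport U v \<psi> \<in> fibre B (face1 (bd2 c))"
    proof (cases "v = []")
      case True
      with step(2) p have "x = face1 (bd1 c)" by (simp add: paths_def path_start_def)
      with True c \<psi> show ?thesis by (simp add: simplices2_bd)
    next
      case False
      have "(u @ [bd1 c]) @ v \<in> paths x y" using step(2) p by simp
      then obtain z where v: "v \<in> paths x z" and "u @ [bd1 c] \<in> paths z y"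
        using False by (blast elim: paths_appendE)
      then have "z = face1 (bd1 c)" by (simp add: paths_def path_start_def)
      with transport_in_fibre[OF v \<psi>] c show ?thesis by (simp add: simplices2_bd)
    qed
    with c show ?case by (simp add: p q flat)
  qed auto
  then show ?thesis by simp
qed

text \<open>Transitivity provides the group element of each loop, freeness makes it unique, and
  homotopy invariance lets it descend to classes. As transport commutes with the right action, going
  along \<open>q\<close> and then \<open>p\<close> yields \<open>h p \<otimes> h q\<close> in this
  order: a homomorphism, not an anti-homomorphism.\<close>

lemma ex_holonomy:
  assumes \<psi>: "\<psi> \<in> fibre B a"
  shows "\<exists>\<chi>\<in>hom (fundamental_group a) G. holonomy_at (B, U) a \<psi> \<chi>"
proof -
  define h where "h p = (SOME g. g \<in> carrier G \<and> transport U p \<psi> = act B \<psi> g)" for p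
  have h: "h p \<in> carrier G \<and> transport U p \<psi> = act B \<psi> (h p)" if "p \<in> paths a a" for p
    unfolding h_def
    using someI_ex[of "\<lambda>g. g \<in> carrier G \<and> transport U p \<psi> = act B \<psi> g"]
      act_transitive[OF \<psi> transport_in_fibre[OF that \<psi>]] by blast
  define \<chi> where "\<chi> X = h (SOME p. p \<in> paths a a \<and> X = loop_class a p)" for X
  have \<chi>: "\<chi> (loop_class a p) = h p" if p: "p \<in> paths a a" for p
  proof -
    define q where "q = (SOME q. q \<in> paths a a \<and> loop_class a p = loop_class a q)"
    have q: "q \<in> paths a a \<and> loop_class a p = loop_class a q"
      unfolding q_def using p by (intro someI) auto
    then have "path_homotopic p q" using loop_class_eq_iff p by blast
    then have "transport U p \<psi> = transport U q \<psi>" using transport_homotopic p \<psi> by blast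
    \<comment> \<open>\<open>h\<close> depends on a path only through the transported point, so
      equal transports select the same element.\<close>
    then have "h p = h q" unfolding h_def by simp
    then show ?thesis by (simp add: \<chi>_def q_def)
  qed
  have mult: "h (p @ q) = h p \<otimes> h q" if p: "p \<in> paths a a" and q: "q \<in> paths a a" for p q
  proof -
    have "act B \<psi> (h (p @ q)) = transport U p (act B \<psi> (h q))"
      using h[OF paths_append[OF p q]] h[OF q] by simp
    also have "\<dots> = act B \<psi> (h p \<otimes> h q)"
      using transport_equivariant[OF p \<psi>] h[OF p] h[OF q] act_act[OF \<psi>] by simp
    finally show ?thesis
      using act_cancel[OF \<psi>] h paths_append[OF p q] p q by simp
  qed
  have "\<chi> \<in> hom (fundamental_group a) G"
    by (rule homI) (auto simp: carrier_fundamental_group \<chi> h mult loop_class_mult paths_append)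
  moreover have "holonomy_at (B, U) a \<psi> \<chi>"
    using \<psi> h by (simp add: holonomy_at_def \<chi>)
  ultimately show ?thesis by blast
qed

text \<open>Referred back to \<open>\<psi>\<close>, the two sides of the holonomy equation at the
  new base point become the actions of \<open>\<chi>[p] \<otimes> g\<close> and
  \<open>g \<otimes> \<chi>'[p]\<close>, and freeness compares them. One direction extracts
  conjugacy from an equivalence, the other moves the base point to make holonomies equal.\<close>

lemma holonomy_at_act:
  assumes hol: "holonomy_at (B, U) a \<psi> \<chi>" and \<chi>: "\<chi> \<in> hom (fundamental_group a) G"
    and \<chi>': "\<chi>' \<in> hom (fundamental_group a) G" and g: "g \<in> carrier G"
  shows "holonomy_at (B, U) a (act B \<psi> g) \<chi>' \<longleftrightarrow>
    (\<forall>X\<in>carrier (fundamental_group a). \<chi> X = g \<otimes> \<chi>' X \<otimes> inv g)"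
proof -
  have \<psi>: "\<psi> \<in> fibre B a" using hol by (simp add: holonomy_at_def)
  have "transport U p (act B \<psi> g) = act B (act B \<psi> g) (\<chi>' (loop_class a p)) \<longleftrightarrow>
      \<chi> (loop_class a p) = g \<otimes> \<chi>' (loop_class a p) \<otimes> inv g" (is "?L \<longleftrightarrow> ?R")
    if p: "p \<in> paths a a" for p
  proof -
    note c = hom_loop_class[OF \<chi> p] hom_loop_class[OF \<chi>' p]
    have "transport U p (act B \<psi> g) = act B \<psi> (\<chi> (loop_class a p) \<otimes> g)"
      using hol p transport_equivariant[OF p \<psi> g] act_act[OF \<psi>] c g
      by (simp add: holonomy_at_def)
    moreover have "act B (act B \<psi> g) (\<chi>' (loop_class a p)) = act B \<psi> (g \<otimes> \<chi>' (loop_class a p))"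
      using act_act[OF \<psi>] c g by simp
    ultimately have "?L \<longleftrightarrow> \<chi> (loop_class a p) \<otimes> g = g \<otimes> \<chi>' (loop_class a p)"
      using act_cancel[OF \<psi>] c g by (metis m_closed)
    also have "\<dots> \<longleftrightarrow> ?R"
      using c g inv_solve_right' by (metis m_closed)
    finally show ?thesis .
  qed
  then show ?thesis
    using act_in_fibre[OF \<psi> g]
    by (auto simp: holonomy_at_def carrier_fundamental_group)
qed

end

section \<open>Equivalence of connections and conjugacy of holonomies\<close>

lemma equivalent_imp_hom_equiv:
  assumes "flat_net_connection G B' U'" "flat_net_connection G B U"
    and eq: "connections_equivalent G (B', U') (B, U)"
    and hol': "holonomy_at (B', U') a \<psi>' \<chi>'" and \<chi>': "\<chi>' \<in> hom (fundamental_group a) G"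
    and hol: "holonomy_at (B, U) a \<psi> \<chi>" and \<chi>: "\<chi> \<in> hom (fundamental_group a) G"
  shows "(\<chi>, \<chi>') \<in> hom_equiv (fundamental_group a) G"
proof -
  interpret C': flat_net_connection G B' U' by fact
  interpret C: flat_net_connection G B U by fact
  obtain f where f: "bundle_morphism G B' B f"
    and fU: "\<And>b \<phi>. \<lbrakk>b \<in> simplices1; \<phi> \<in> fibre B' (face1 b)\<rbrakk> \<Longrightarrow> f (U' b \<phi>) = U b (f \<phi>)"
    using eq by (auto simp: connections_equivalent_def)
  have fibre: "f \<phi> \<in> fibre B x" if "\<phi> \<in> fibre B' x" for \<phi> x
    using f that by (simp add: bundle_morphism_def fibre_def)
  have act: "f (act B' \<phi> g) = act B (f \<phi>) g" if "\<phi> \<in> fibre B' x" "g \<in> carrier G" for \<phi> x g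
    using f that by (simp add: bundle_morphism_def fibre_def)
  have tr: "f (transport U' p \<phi>) = transport U p (f \<phi>)"
    if "p \<in> paths x y" "\<phi> \<in> fibre B' x" for p x y \<phi>
    using that by (induction rule: paths_induct) (simp_all add: fU C'.transport_in_fibre)
  have \<psi>': "\<psi>' \<in> fibre B' a" and \<psi>: "\<psi> \<in> fibre B a"
    using hol' hol by (simp_all add: holonomy_at_def)
  \<comment> \<open>The morphism carries the holonomy at \<open>\<psi>'\<close> unchanged to
    \<open>f \<psi>'\<close>; comparing \<open>f \<psi>'\<close> with \<open>\<psi>\<close> in their
    common fibre then supplies the conjugating element.\<close>
  have "transport U p (f \<psi>') = act B (f \<psi>') (\<chi>' (loop_class a p))" if p: "p \<in> paths a a" for p
    using tr[OF p \<psi>'] act[OF \<psi>' hom_loop_class[OF \<chi>' p]] hol' p by (simp add: holonomy_at_def)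
  then have "holonomy_at (B, U) a (f \<psi>') \<chi>'"
    using fibre[OF \<psi>'] by (simp add: holonomy_at_def)
  moreover obtain g where g: "g \<in> carrier G" "f \<psi>' = act B \<psi> g"
    using C.act_transitive[OF \<psi> fibre[OF \<psi>']] by blast
  ultimately show ?thesis
    using C.holonomy_at_act[OF hol \<chi> \<chi>'] \<chi> \<chi>' by (auto simp: hom_equiv_def)
qed

text \<open>Send \<open>U'(p) \<psi>' \<cdot> g\<close> to \<open>U(p) \<psi> \<cdot> g\<close>. By
  pathwise connectedness such points exhaust all fibres, and two descriptions of one point differ by
  the holonomy of a loop, which is the same group element on both sides.\<close>

lemma same_holonomy_imp_equivalent:
  fixes a :: "'k::order"
  assumes conn: "pathwise_connected TYPE('k)"
    and "flat_net_connection G B' U'" "flat_net_connection G B U"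
    and \<chi>: "\<chi> \<in> hom (fundamental_group a) G"
    and hol': "holonomy_at (B', U') a \<psi>' \<chi>" and hol: "holonomy_at (B, U) a \<psi> \<chi>"
  shows "connections_equivalent G (B', U') (B, U)"
proof -
  interpret C': flat_net_connection G B' U' by fact
  interpret C: flat_net_connection G B U by fact
  have \<psi>': "\<psi>' \<in> fibre B' a" and \<psi>: "\<psi> \<in> fibre B a"
    using hol' hol by (simp_all add: holonomy_at_def)
  \<comment> \<open>The graph of the intended map; \<open>total\<close> shows that it is defined
    everywhere, \<open>unique\<close> that it is single-valued.\<close>
  define R where "R \<phi>' \<phi> \<longleftrightarrow> (\<exists>p x g. p \<in> paths a x \<and> g \<in> carrier G \<and>
    \<phi>' = act B' (transport U' p \<psi>') g \<and> \<phi> = act B (transport U p \<psi>) g)" for \<phi>' \<phi>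
  have RI: "R (act B' (transport U' p \<psi>') g) (act B (transport U p \<psi>) g)"
    if "p \<in> paths a x" "g \<in> carrier G" for p x g
    using that by (auto simp: R_def)
  have total: "\<exists>p g. p \<in> paths a x \<and> g \<in> carrier G \<and> \<phi> = act B' (transport U' p \<psi>') g"
    if \<phi>: "\<phi> \<in> fibre B' x" for \<phi> x
  proof -
    obtain p where "p \<in> paths a x"
      using conn by (auto simp: pathwise_connected_def paths_def)
    with C'.act_transitive[OF C'.transport_in_fibre[OF _ \<psi>'] \<phi>] show ?thesis by blast
  qed
  have unique: "act B (transport U p \<psi>) g = act B (transport U q \<psi>) h"
    if p: "p \<in> paths a x" and g: "g \<in> carrier G" and q: "q \<in> paths a y" and h: "h \<in> carrier G"
      and eq: "act B' (transport U' p \<psi>') g = act B' (transport U' q \<psi>') h" for p q x y g h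
  proof -
    have "act B' (transport U' p \<psi>') g \<in> fibre B' x" "act B' (transport U' q \<psi>') h \<in> fibre B' y"
      using C'.act_in_fibre C'.transport_in_fibre \<psi>' p g q h by blast+
    with eq have "y = x" by (simp add: fibre_def)
    with q have q: "q \<in> paths a x" by simp
    \<comment> \<open>Going out along \<open>p\<close> and back along \<open>q\<close> turns the
      coincidence of the two points into the identity \<open>h = k \<otimes> g\<close> in the group.
      Since \<open>k\<close> comes from the common \<open>\<chi>\<close>, the identity can then be
      read in the other bundle.\<close>
    define l where "l = rev_path q @ p"
    have l: "l \<in> paths a a" unfolding l_def using paths_append[OF rev_path_in_paths[OF q] p] .
    define k where "k = \<chi> (loop_class a l)"
    have k: "k \<in> carrier G" unfolding k_def using hom_loop_class[OF \<chi> l] .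
    have l': "transport U' l \<psi>' = act B' \<psi>' k" and lk: "transport U l \<psi> = act B \<psi> k"
      using hol' hol l by (auto simp: holonomy_at_def k_def)
    have "act B' \<psi>' h = transport U' (rev_path q) (act B' (transport U' q \<psi>') h)"
      using C'.transport_equivariant[OF q \<psi>' h] C'.transport_rev_path[OF q C'.act_in_fibre[OF \<psi>' h]]
      by simp
    also have "\<dots> = transport U' l (act B' \<psi>' g)"
      using C'.transport_equivariant[OF p \<psi>' g] eq by (simp add: l_def)
    also have "\<dots> = act B' \<psi>' (k \<otimes>\<^bsub>G\<^esub> g)"
      using C'.transport_equivariant[OF l \<psi>' g] C'.act_act[OF \<psi>' k g] l' by simp
    finally have "h = k \<otimes>\<^bsub>G\<^esub> g"
      using C'.act_cancel[OF \<psi>'] h k g by simp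
    then have "act B \<psi> h = transport U (rev_path q) (transport U p (act B \<psi> g))"
      using C.transport_equivariant[OF l \<psi> g] C.act_act[OF \<psi> k g] lk by (simp add: l_def)
    then have "transport U q (act B \<psi> h) = transport U p (act B \<psi> g)"
      using C.transport_rev_path[OF rev_path_in_paths[OF q]
          C.transport_in_fibre[OF p C.act_in_fibre[OF \<psi> g]]]
      by simp
    then show ?thesis
      using C.transport_equivariant p q \<psi> g h by simp
  qed
  define f where "f \<phi>' = (SOME \<phi>. R \<phi>' \<phi>)" for \<phi>'
  have f: "f (act B' (transport U' p \<psi>') g) = act B (transport U p \<psi>) g"
    if "p \<in> paths a x" "g \<in> carrier G" for p x g
  proof -
    have "R (act B' (transport U' p \<psi>') g) (f (act B' (transport U' p \<psi>') g))"
      unfolding f_def using RI[OF that] by (rule someI)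
    then obtain q y h where "q \<in> paths a y" "h \<in> carrier G"
      and "act B' (transport U' p \<psi>') g = act B' (transport U' q \<psi>') h"
      and "f (act B' (transport U' p \<psi>') g) = act B (transport U q \<psi>) h"
      unfolding R_def by blast
    then show ?thesis using unique[OF that] by simp
  qed
  have fibre: "f \<phi> \<in> fibre B x" if \<phi>: "\<phi> \<in> fibre B' x" for \<phi> x
  proof -
    obtain p h where p: "p \<in> paths a x" and h: "h \<in> carrier G"
      and \<phi>_eq: "\<phi> = act B' (transport U' p \<psi>') h"
      using total[OF \<phi>] by blast
    show ?thesis
      using C.act_in_fibre[OF C.transport_in_fibre[OF p \<psi>] h] f[OF p h] by (simp add: \<phi>_eq)
  qed
  have act: "f (act B' \<phi> g) = act B (f \<phi>) g" if \<phi>: "\<phi> \<in> fibre B' x" and g: "g \<in> carrier G" for \<phi> x g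
  proof -
    obtain p h where p: "p \<in> paths a x" and h: "h \<in> carrier G"
      and \<phi>_eq: "\<phi> = act B' (transport U' p \<psi>') h"
      using total[OF \<phi>] by blast
    show ?thesis
      using f[OF p h] f[OF p, of "h \<otimes>\<^bsub>G\<^esub> g"] h g
        C'.act_act[OF C'.transport_in_fibre[OF p \<psi>'] h g]
        C.act_act[OF C.transport_in_fibre[OF p \<psi>] h g]
      by (simp add: \<phi>_eq)
  qed
  \<comment> \<open>Prolonging \<open>p\<close> by the edge \<open>b\<close> gives a description of
    \<open>U' b \<phi>\<close> with the same group element.\<close>
  have fU: "f (U' b \<phi>) = U b (f \<phi>)" if b: "b \<in> simplices1" and \<phi>: "\<phi> \<in> fibre B' (face1 b)" for b \<phi>
  proof -
    obtain p h where p: "p \<in> paths a (face1 b)" and h: "h \<in> carrier G"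
      and \<phi>_eq: "\<phi> = act B' (transport U' p \<psi>') h"
      using total[OF \<phi>] by blast
    show ?thesis
      using f[OF p h] f[OF paths_Cons[OF b p] h]
        C'.conn_equivariant[OF b C'.transport_in_fibre[OF p \<psi>'] h]
        C.conn_equivariant[OF b C.transport_in_fibre[OF p \<psi>] h]
      by (simp add: \<phi>_eq)
  qed
  have "bundle_morphism G B' B f"
    unfolding bundle_morphism_def
  proof (intro conjI ballI)
    fix \<phi> assume "\<phi> \<in> total B'"
    then have \<phi>: "\<phi> \<in> fibre B' (proj B' \<phi>)" by (simp add: fibre_def)
    show "f \<phi> \<in> total B" "proj B (f \<phi>) = proj B' \<phi>"
      using fibre[OF \<phi>] by (simp_all add: fibre_def)
    show "f (act B' \<phi> g) = act B (f \<phi>) g" if "g \<in> carrier G" for g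
      using act[OF \<phi> that] .
  next
    fix b :: "'k simplex1" and \<phi> assume b: "b \<in> nerve1" and \<phi>: "\<phi> \<in> fibre B' (face1 b)"
    \<comment> \<open>On the nerve both connections agree with the net structures, so this is a case
      of \<open>fU\<close>.\<close>
    show "net B b (f \<phi>) = f (net B' b \<phi>)"
      using C.conn_nerve[OF b fibre[OF \<phi>]] C'.conn_nerve[OF b \<phi>] fU[OF _ \<phi>] b
        nerve1_subset_simplices1 by auto
  qed
  then show ?thesis
    using fU by (auto simp: connections_equivalent_def)
qed

text \<open>Moving the base point of the second bundle by the conjugating element makes both
  holonomies equal to \<open>\<chi>'\<close>.\<close>

lemma hom_equiv_imp_equivalent:
  fixes a :: "'k::order"
  assumes conn: "pathwise_connected TYPE('k)"
    and C': "flat_net_connection G B' U'" and C: "flat_net_connection G B U"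
    and hol': "holonomy_at (B', U') a \<psi>' \<chi>'" and hol: "holonomy_at (B, U) a \<psi> \<chi>"
    and eq: "(\<chi>, \<chi>') \<in> hom_equiv (fundamental_group a) G"
  shows "connections_equivalent G (B', U') (B, U)"
proof -
  interpret C: flat_net_connection G B U by fact
  from eq obtain g where \<chi>: "\<chi> \<in> hom (fundamental_group a) G"
    and \<chi>': "\<chi>' \<in> hom (fundamental_group a) G" and g: "g \<in> carrier G"
    and "\<forall>X\<in>carrier (fundamental_group a). \<chi> X = g \<otimes>\<^bsub>G\<^esub> \<chi>' X \<otimes>\<^bsub>G\<^esub> inv\<^bsub>G\<^esub> g"
    by (auto simp: hom_equiv_def)
  then have "holonomy_at (B, U) a (act B \<psi> g) \<chi>'"
    using C.holonomy_at_act[OF hol \<chi> \<chi>' g] by blast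
  then show ?thesis
    using same_holonomy_imp_equivalent[OF conn C' C \<chi>' hol'] by blast
qed


section \<open>The flat connection of a cocycle\<close>

text \<open>In coordinates this is \<open>(x, g) \<mapsto> (face0 b, z b \<otimes> g)\<close>, where
  \<open>\<iota>\<close> places the product of poset and group inside the type \<open>'p\<close>.
  Left multiplication is used because it commutes with the right action.\<close>

definition cocycle_connection ::
  "('g, 'm) monoid_scheme \<Rightarrow> ('k::order \<times> 'g \<Rightarrow> 'p) \<Rightarrow> ('k simplex1 \<Rightarrow> 'g) \<Rightarrow>
   'k simplex1 \<Rightarrow> 'p \<Rightarrow> 'p" where
  "cocycle_connection G \<iota> z b \<phi> =
     \<iota> (face0 b, z b \<otimes>\<^bsub>G\<^esub> snd (inv_into (UNIV \<times> carrier G) \<iota> \<phi>))"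

text \<open>Taking the connection itself as net structure makes the two agree on the nerve by
  construction.\<close>

definition cocycle_bundle ::
  "('g, 'm) monoid_scheme \<Rightarrow> ('k::order \<times> 'g \<Rightarrow> 'p) \<Rightarrow> ('k simplex1 \<Rightarrow> 'g) \<Rightarrow>
   ('k, 'g, 'p) net_bundle" where
  "cocycle_bundle G \<iota> z =
     \<lparr>total = \<iota> ` (UNIV \<times> carrier G),
      proj = \<lambda>\<phi>. fst (inv_into (UNIV \<times> carrier G) \<iota> \<phi>),
      net = cocycle_connection G \<iota> z,
      act = \<lambda>\<phi> g. let (x, h) = inv_into (UNIV \<times> carrier G) \<iota> \<phi> in \<iota> (x, h \<otimes>\<^bsub>G\<^esub> g)\<rparr>"

locale cocycle = group G for G :: "('g, 'm) monoid_scheme" (structure) +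
  fixes z :: "'k::order simplex1 \<Rightarrow> 'g" and \<iota> :: "'k \<times> 'g \<Rightarrow> 'p"
  assumes z_closed [simp]: "b \<in> simplices1 \<Longrightarrow> z b \<in> carrier G"
    and z_cocycle: "c \<in> simplices2 \<Longrightarrow> z (bd0 c) \<otimes> z (bd2 c) = z (bd1 c)"
    and inj: "inj_on \<iota> (UNIV \<times> carrier G)"
begin

abbreviation "bun \<equiv> cocycle_bundle G \<iota> z"
abbreviation "con \<equiv> cocycle_connection G \<iota> z"

lemma inv_\<iota> [simp]: "g \<in> carrier G \<Longrightarrow> inv_into (UNIV \<times> carrier G) \<iota> (\<iota> (x, g)) = (x, g)"
  by (rule inv_into_f_f[OF inj]) simp

lemma \<iota>_eq_iff [simp]:
  "\<lbrakk>g \<in> carrier G; h \<in> carrier G\<rbrakk> \<Longrightarrow> \<iota> (x, g) = \<iota> (y, h) \<longleftrightarrow> x = y \<and> g = h"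
  using inj_on_eq_iff[OF inj, of "(x, g)" "(y, h)"] by simp

lemma bun_simps [simp]:
  assumes "g \<in> carrier G"
  shows "proj bun (\<iota> (x, g)) = x" "con b (\<iota> (x, g)) = \<iota> (face0 b, z b \<otimes> g)"
    "act bun (\<iota> (x, g)) h = \<iota> (x, g \<otimes> h)"
  using assms by (simp_all add: cocycle_bundle_def cocycle_connection_def)

lemma net_bun [simp]: "net bun = con"
  by (simp add: cocycle_bundle_def)

lemma total_bun: "total bun = {\<iota> (x, g) |x g. g \<in> carrier G}"
  by (auto simp: cocycle_bundle_def)

lemma fibre_bun: "fibre bun x = {\<iota> (x, g) |g. g \<in> carrier G}"
  by (auto simp: fibre_def total_bun)

text \<open>On the totally degenerate 2-simplex the cocycle identity says that this value is
  idempotent.\<close>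

lemma z_degenerate [simp]: "z (degenerate1 x) = \<one>"
proof -
  have "Simplex2 x (degenerate1 x) (degenerate1 x) (degenerate1 x) \<in> simplices2"
    by (simp add: simplices2_def)
  from z_cocycle[OF this] show ?thesis by (simp add: r_cancel_one)
qed

lemma z_reverse:
  assumes b: "b \<in> simplices1"
  shows "z (reverse1 b) \<otimes> z b = \<one>"
proof -
  have "Simplex2 (supp1 b) (reverse1 b) (degenerate1 (face1 b)) b \<in> simplices2"
    using b by (auto simp: simplices2_def simplices1_def)
  from z_cocycle[OF this] show ?thesis by simp
qed

lemma con_bij:
  assumes b: "b \<in> simplices1"
  shows "bij_betw (con b) (fibre bun (face1 b)) (fibre bun (face0 b))"
proof (rule bij_betw_byWitness[where f' = "con (reverse1 b)"])
  have "z b \<otimes> z (reverse1 b) = \<one>" "z (reverse1 b) \<otimes> z b = \<one>"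
    using z_reverse[of b] z_reverse[of "reverse1 b"] b by simp_all
  then show "\<forall>\<phi>\<in>fibre bun (face1 b). con (reverse1 b) (con b \<phi>) = \<phi>"
    "\<forall>\<phi>\<in>fibre bun (face0 b). con b (con (reverse1 b) \<phi>) = \<phi>"
    using b by (auto simp: fibre_bun simp flip: m_assoc)
qed (use b in \<open>auto simp: fibre_bun\<close>)

lemma con_compose:
  assumes c: "c \<in> simplices2" and \<phi>: "\<phi> \<in> fibre bun (face1 (bd2 c))"
  shows "con (bd0 c) (con (bd2 c) \<phi>) = con (bd1 c) \<phi>"
  using c \<phi> z_cocycle[OF c] by (auto simp: fibre_bun simplices2_bd simp flip: m_assoc)

lemma flat_net_connection_cocycle: "flat_net_connection G bun con"
proof
  show "proj bun ` total bun = UNIV"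
    by (force simp: total_bun image_iff)
  show "\<exists>g\<in>carrier G. \<phi> = act bun \<psi> g" if "\<psi> \<in> fibre bun x" "\<phi> \<in> fibre bun x" for \<psi> \<phi> x
  proof -
    from that obtain g h where "g \<in> carrier G" "h \<in> carrier G" "\<psi> = \<iota> (x, g)" "\<phi> = \<iota> (x, h)"
      by (auto simp: fibre_bun)
    then show ?thesis
      by (intro bexI[of _ "inv g \<otimes> h"]) (simp_all flip: m_assoc)
  qed
  show "con (reverse1 b) \<psi> = inv_into (fibre bun (face1 b)) (con b) \<psi>"
    if b: "b \<in> simplices1" and \<psi>: "\<psi> \<in> fibre bun (face0 b)" for b \<psi>
  proof -
    have "con b (con (reverse1 b) \<psi>) = \<psi>"
      using b \<psi> z_reverse[of "reverse1 b"] by (auto simp: fibre_bun simp flip: m_assoc)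
    moreover have "con (reverse1 b) \<psi> \<in> fibre bun (face1 b)"
      using b \<psi> by (auto simp: fibre_bun)
    ultimately show ?thesis
      using inv_into_f_eq[OF bij_betw_imp_inj_on[OF con_bij[OF b]]] by metis
  qed
  show "net bun (bd0 c) (net bun (bd2 c) \<psi>) = net bun (bd1 c) \<psi>"
    if "c \<in> nerve2" "\<psi> \<in> fibre bun (face1 (bd2 c))" for c \<psi>
    using con_compose that nerve2_subset_simplices2 by auto
  show "bij_betw (net bun b) (fibre bun (face1 b)) (fibre bun (face0 b))" if "b \<in> nerve1" for b
    using con_bij that nerve1_subset_simplices1 by auto
  show "net bun b (act bun \<psi> g) = act bun (net bun b \<psi>) g"
    if "b \<in> nerve1" "\<psi> \<in> fibre bun (face1 b)" "g \<in> carrier G" for b \<psi> g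
    using that nerve1_subset_simplices1 by (auto simp: fibre_bun m_assoc subset_iff)
qed (auto simp: total_bun con_bij con_compose, auto simp: fibre_bun m_assoc)

end


section \<open>Realizing a homomorphism as holonomy\<close>

text \<open>Read off from multiplicativity: the class of the constant loop is idempotent, so its
  value is \<open>\<one>\<close>, and \<open>rev_path p @ p\<close> lies in that class.\<close>

lemma hom_rev_path:
  fixes G (structure)
  assumes "group G" and \<chi>: "\<chi> \<in> hom (fundamental_group a) G" and p: "p \<in> paths a a"
  shows "\<chi> (loop_class a (rev_path p)) \<otimes> \<chi> (loop_class a p) = \<one>"
proof -
  interpret group G by fact
  have d: "[degenerate1 a] \<in> paths a a" by (rule degenerate_path)
  have "loop_class a ([degenerate1 a] @ [degenerate1 a]) = loop_class a [degenerate1 a]"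
    using loop_class_eq_iff[OF paths_append[OF d d] d] degenerate_append_homotopic[OF d] by blast
  then have "\<chi> (loop_class a [degenerate1 a]) = \<one>"
    using hom_loop_class_append[OF \<chi> d d] hom_loop_class[OF \<chi> d] by (metis r_cancel_one)
  moreover have "loop_class a (rev_path p @ p) = loop_class a [degenerate1 a]"
    using loop_class_eq_iff[OF paths_append[OF rev_path_in_paths[OF p] p] d]
      rev_path_append_homotopic[OF p] by blast
  ultimately show ?thesis
    using hom_loop_class_append[OF \<chi> rev_path_in_paths[OF p] p] by simp
qed

text \<open>
  The cocycle built from the chosen paths \<open>\<gamma>\<close> has holonomy conjugate to \<open>\<chi>\<close> by its value on the
  loop \<open>\<gamma> a\<close>, which need not be trivial; the base point \<open>\<iota> (a, k)\<close> absorbs this.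
\<close>

lemma ex_connection_with_holonomy:
  fixes G :: "('g, 'm) monoid_scheme" (structure) and a :: "'k::order"
    and \<iota> :: "'k \<times> 'g \<Rightarrow> 'p"
  assumes "group G" and conn: "pathwise_connected TYPE('k)"
    and inj: "inj_on \<iota> (UNIV \<times> carrier G)" and \<chi>: "\<chi> \<in> hom (fundamental_group a) G"
  shows "\<exists>(B :: ('k, 'g, 'p) net_bundle) U \<psi>. flat_net_connection G B U \<and> holonomy_at (B, U) a \<psi> \<chi>"
proof -
  interpret group G by fact
  obtain \<gamma> where \<gamma>: "\<gamma> x \<in> paths a x" for x
    using conn unfolding pathwise_connected_def paths_def by (simp add: Bex_def) metis
  define close where "close x y p = rev_path (\<gamma> y) @ p @ \<gamma> x" for x y p
  have close: "close x y p \<in> paths a a" if "p \<in> paths x y" for p x y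
    unfolding close_def using paths_append rev_path_in_paths \<gamma> that by blast
  \<comment> \<open>Defined for all paths and not only for edges, so that one multiplicativity law
    yields both the cocycle identity and the formula for transport.\<close>
  define \<zeta> where "\<zeta> x y p = \<chi> (loop_class a (close x y p))" for x y p
  have \<zeta>_closed: "\<zeta> x y p \<in> carrier G" if "p \<in> paths x y" for p x y
    unfolding \<zeta>_def using hom_loop_class[OF \<chi> close[OF that]] .
  have \<zeta>_homotopic: "\<zeta> x y p = \<zeta> x y q"
    if p: "p \<in> paths x y" and pq: "path_homotopic p q" for p q x y
  proof -
    have "path_homotopic (p @ \<gamma> x) (q @ \<gamma> x)"
      using path_homotopic_append[OF pq p path_homotopic_refl \<gamma>] .
    then have "path_homotopic (close x y p) (close x y q)"
      unfolding close_def
      using path_homotopic_append path_homotopic_refl rev_path_in_paths[OF \<gamma>] paths_append[OF p \<gamma>]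
      by blast
    then show ?thesis
      unfolding \<zeta>_def
      using loop_class_eq_iff close p path_homotopic_in_paths[OF pq p] by metis
  qed
  \<comment> \<open>In the product of the two closed-up loops, the return along
    \<open>\<gamma> y\<close> and the new departure along it cancel up to homotopy.\<close>
  have \<zeta>_append: "\<zeta> x w (p @ q) = \<zeta> y w p \<otimes> \<zeta> x y q"
    if p: "p \<in> paths y w" and q: "q \<in> paths x y" for p q x y w
  proof -
    have "path_homotopic ((rev_path (\<gamma> w) @ p) @ \<gamma> y @ rev_path (\<gamma> y) @ (q @ \<gamma> x))
        ((rev_path (\<gamma> w) @ p) @ (q @ \<gamma> x))"
      using cancel_rev_path_homotopic[OF paths_append[OF rev_path_in_paths[OF \<gamma>] p] \<gamma>
          paths_append[OF q \<gamma>]] .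
    then have "path_homotopic (close y w p @ close x y q) (close x w (p @ q))"
      by (simp add: close_def)
    then have "loop_class a (close y w p @ close x y q) = loop_class a (close x w (p @ q))"
      using loop_class_eq_iff[OF paths_append[OF close[OF p] close[OF q]]
          close[OF paths_append[OF p q]]] by simp
    then show ?thesis
      unfolding \<zeta>_def using hom_loop_class_append[OF \<chi> close[OF p] close[OF q]] by simp
  qed
  define z where "z b = \<zeta> (face1 b) (face0 b) [b]" for b
  interpret cocycle G z \<iota>
  proof
    show "z b \<in> carrier G" if "b \<in> simplices1" for b
      unfolding z_def using \<zeta>_closed[OF paths_singleton[OF that]] .
    show "z (bd0 c) \<otimes> z (bd2 c) = z (bd1 c)" if c: "c \<in> simplices2" for c
    proof -
      have p: "[bd0 c] \<in> paths (face1 (bd0 c)) (face0 (bd1 c))"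
        "[bd2 c] \<in> paths (face1 (bd1 c)) (face1 (bd0 c))"
        using paths_singleton[of "bd0 c"] paths_singleton[of "bd2 c"] c by (simp_all add: simplices2_bd)
      show ?thesis
        using \<zeta>_append[OF p] \<zeta>_homotopic[OF paths_append[OF p]] simplex2_homotopic[OF c] c
        by (simp add: z_def simplices2_bd)
    qed
  qed (rule inj)
  have transport: "transport con p (\<iota> (x, g)) = \<iota> (y, \<zeta> x y p \<otimes> g)"
    if "p \<in> paths x y" and g: "g \<in> carrier G" for p x y g
    using that(1)
  proof (induction rule: paths_induct)
    case (single b)
    then show ?case using g by (simp flip: z_def)
  next
    case (Cons b p x)
    then show ?case
      using \<zeta>_append[OF paths_singleton[OF Cons.hyps(1)] Cons.hyps(2)]
        \<zeta>_closed[OF Cons.hyps(2)] z_closed[OF Cons.hyps(1)] g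
      by (simp add: m_assoc flip: z_def)
  qed
  define k where "k = \<chi> (loop_class a (rev_path (\<gamma> a)))"
  have k: "k \<in> carrier G"
    unfolding k_def using hom_loop_class[OF \<chi> rev_path_in_paths[OF \<gamma>]] .
  have "holonomy_at (bun, con) a (\<iota> (a, k)) \<chi>"
    unfolding holonomy_at_def
  proof (intro conjI ballI)
    show "\<iota> (a, k) \<in> fibre (fst (bun, con)) a" using k by (auto simp: fibre_bun)
    fix p assume p: "p \<in> paths a a"
    have \<gamma>k: "\<chi> (loop_class a (\<gamma> a)) \<otimes> k = \<one>"
      using hom_rev_path[OF \<open>group G\<close> \<chi> rev_path_in_paths[OF \<gamma>]] by (simp add: k_def)
    note c = hom_loop_class[OF \<chi> p] hom_loop_class[OF \<chi> \<gamma>[of a]]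
    \<comment> \<open>Here \<open>\<gamma> a\<close> is itself a loop, so \<open>\<chi>\<close>
      splits over the three pieces; the last factor is inverse to \<open>k\<close>.\<close>
    have "\<zeta> a a p = k \<otimes> (\<chi> (loop_class a p) \<otimes> \<chi> (loop_class a (\<gamma> a)))"
      unfolding \<zeta>_def close_def k_def
      using hom_loop_class_append[OF \<chi> rev_path_in_paths[OF \<gamma>] paths_append[OF p \<gamma>]]
        hom_loop_class_append[OF \<chi> p \<gamma>] by simp
    then have "\<zeta> a a p \<otimes> k = k \<otimes> \<chi> (loop_class a p)"
      using \<gamma>k c k by (simp add: m_assoc)
    then show "transport (snd (bun, con)) p (\<iota> (a, k)) = act (fst (bun, con)) (\<iota> (a, k)) (\<chi> (loop_class a p))"
      using transport[OF p k] k by simp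
  qed
  with flat_net_connection_cocycle show ?thesis by blast
qed


section \<open>The correspondence\<close>

lemma equiv_hom_equiv:
  fixes G (structure)
  assumes "group G"
  shows "equiv (hom H G) (hom_equiv H G)"
proof -
  interpret group G by fact
  have closed: "\<chi> x \<in> carrier G" if "\<chi> \<in> hom H G" "x \<in> carrier H" for \<chi> x
    using that by (rule hom_in_carrier)
  show ?thesis
  proof (rule equivI)
    show "hom_equiv H G \<subseteq> hom H G \<times> hom H G" by (auto simp: hom_equiv_def)
    show "refl_on (hom H G) (hom_equiv H G)"
      by (auto simp: refl_on_def hom_equiv_def closed intro!: bexI[of _ \<one>])
    show "sym (hom_equiv H G)"
    proof (rule symI)
      fix \<chi>' \<chi> assume "(\<chi>', \<chi>) \<in> hom_equiv H G"
      then obtain g where "\<chi>' \<in> hom H G" "\<chi> \<in> hom H G" and g: "g \<in> carrier G"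
        and eq: "\<And>x. x \<in> carrier H \<Longrightarrow> \<chi>' x = g \<otimes> \<chi> x \<otimes> inv g"
        by (auto simp: hom_equiv_def)
      moreover have "\<chi> x = inv g \<otimes> \<chi>' x \<otimes> inv (inv g)" if "x \<in> carrier H" for x
        using eq[OF that] closed[OF \<open>\<chi> \<in> hom H G\<close> that] g
        by (simp add: m_assoc inv_solve_left)
      ultimately show "(\<chi>, \<chi>') \<in> hom_equiv H G"
        by (auto simp: hom_equiv_def intro!: bexI[of _ "inv g"])
    qed
    show "trans (hom_equiv H G)"
    proof (rule transI)
      fix \<chi>'' \<chi>' \<chi> assume "(\<chi>'', \<chi>') \<in> hom_equiv H G" "(\<chi>', \<chi>) \<in> hom_equiv H G"
      then obtain g h where "\<chi>'' \<in> hom H G" "\<chi> \<in> hom H G" "g \<in> carrier G" "h \<in> carrier G"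
        and "\<And>x. x \<in> carrier H \<Longrightarrow> \<chi>'' x = g \<otimes> (h \<otimes> \<chi> x \<otimes> inv h) \<otimes> inv g"
        by (auto simp: hom_equiv_def)
      then show "(\<chi>'', \<chi>) \<in> hom_equiv H G"
        by (auto simp: hom_equiv_def m_assoc inv_mult_group closed intro!: bexI[of _ "g \<otimes> h"])
    qed
  qed
qed

text \<open>The relation \<open>r\<close> is the pull-back of \<open>s\<close> along
  \<open>h\<close>, so \<open>h\<close> induces an injection on classes, and it meets every class of
  \<open>s\<close>. The image of a class under \<open>h\<close> may be only part of a class, hence
  it is saturated by \<open>s\<close>.\<close>

lemma ex_bij_betw_quotient:
  assumes s: "equiv B s" and h: "h ` A \<subseteq> B"
    and r: "r \<subseteq> A \<times> A" "\<And>x y. \<lbrakk>x \<in> A; y \<in> A\<rbrakk> \<Longrightarrow> (x, y) \<in> r \<longleftrightarrow> (h x, h y) \<in> s"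
    and surj: "\<And>y. y \<in> B \<Longrightarrow> \<exists>x\<in>A. (h x, y) \<in> s"
  shows "\<exists>\<Phi>. bij_betw \<Phi> (A // r) (B // s)"
proof -
  have s_class: "(u, v) \<in> s \<longleftrightarrow> s `` {u} = s `` {v}" if "u \<in> B" "v \<in> B" for u v
    using eq_equiv_class_iff[OF s that] by simp
  have hB: "h x \<in> B" if "x \<in> A" for x
    using h that by blast
  have r_class: "r `` {x} = {y \<in> A. s `` {h x} = s `` {h y}}" if "x \<in> A" for x
    using r that s_class[OF hB hB] by blast
  have \<Phi>: "s `` (h ` (r `` {x})) = s `` {h x}" if "x \<in> A" for x
    using that unfolding r_class[OF that] by auto
  have r_eq: "r `` {x} = r `` {y}" if "x \<in> A" "y \<in> A" "s `` {h x} = s `` {h y}" for x y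
    using that r_class by simp
  have "bij_betw (\<lambda>X. s `` (h ` X)) (A // r) (B // s)"
  proof (rule bij_betwI')
    fix X Y assume "X \<in> A // r" "Y \<in> A // r"
    then obtain x y where "x \<in> A" "X = r `` {x}" "y \<in> A" "Y = r `` {y}"
      by (auto elim!: quotientE)
    then show "s `` (h ` X) = s `` (h ` Y) \<longleftrightarrow> X = Y"
      using \<Phi> r_eq by metis
  next
    fix X assume "X \<in> A // r"
    then show "s `` (h ` X) \<in> B // s"
      using \<Phi> h by (auto elim!: quotientE intro!: quotientI)
  next
    fix Y assume "Y \<in> B // s"
    then obtain y where "y \<in> B" "Y = s `` {y}" by (auto elim: quotientE)
    moreover obtain x where "x \<in> A" "(h x, y) \<in> s" using surj[OF \<open>y \<in> B\<close>] by blast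
    ultimately have "Y = s `` (h ` (r `` {x}))"
      using \<Phi> equiv_class_eq[OF s] by metis
    then show "\<exists>X\<in>A // r. Y = s `` (h ` X)"
      using \<open>x \<in> A\<close> quotientI by metis
  qed
  then show ?thesis by blast
qed

lemma flat_connection_ex_holonomy:
  assumes "C \<in> flat_connections G"
  shows "\<exists>\<chi> \<psi>. \<chi> \<in> hom (fundamental_group a) G \<and> holonomy_at C a \<psi> \<chi>"
proof -
  obtain B U where C: "C = (B, U)" and flat: "flat_net_connection G B U"
    using assms by (auto simp: flat_connections_def)
  interpret flat_net_connection G B U by fact
  obtain \<psi> where "\<psi> \<in> fibre B a" using fibre_nonempty by blast
  then show ?thesis using ex_holonomy C by blast
qed

text \<open>The injection \<open>\<iota>\<close> gives \<open>'p\<close> room for the product of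
  poset and group, hence for a realization of every homomorphism. The second conjunct shows that
  fixing this type loses no equivalence class: a flat connection with total space in another type
  \<open>'q\<close> is equivalent to one counted by the bijection.\<close>

theorem corollary7p2:
  fixes G :: "('g, 'm) monoid_scheme"
    and a :: "'k::order"
    and \<iota> :: "'k \<times> 'g \<Rightarrow> 'p"
  assumes "group G"
    and "pathwise_connected TYPE('k)"
    and total_space_type_large: "inj_on \<iota> (UNIV \<times> carrier G)"
  shows "(\<exists>\<Phi>. bij_betw \<Phi>
            ((flat_connections G :: ('k, 'g, 'p) bundle_connection set) // flat_connection_equiv G)
            (hom (fundamental_group a) G // hom_equiv (fundamental_group a) G))
       \<and> (\<forall>C \<in> (flat_connections G :: ('k, 'g, 'q) bundle_connection set).
            \<exists>C' \<in> (flat_connections G :: ('k, 'g, 'p) bundle_connection set).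
              connections_equivalent G C C')"
proof (intro conjI ballI)
  let ?s = "hom_equiv (fundamental_group a) G"
  have s: "equiv (hom (fundamental_group a) G) ?s"
    using equiv_hom_equiv assms(1) .
  have realize: "\<exists>C \<psi>. C \<in> (flat_connections G :: ('k, 'g, 'p) bundle_connection set) \<and>
      holonomy_at C a \<psi> \<chi>" if "\<chi> \<in> hom (fundamental_group a) G" for \<chi>
    using ex_connection_with_holonomy[OF assms that] by (auto simp: flat_connections_def)
  have hom_equiv: "(\<chi>', \<chi>) \<in> ?s"
    if "C' \<in> flat_connections G" "C \<in> flat_connections G" "connections_equivalent G C' C"
      "holonomy_at C' a \<psi>' \<chi>'" "\<chi>' \<in> hom (fundamental_group a) G"
      "holonomy_at C a \<psi> \<chi>" "\<chi> \<in> hom (fundamental_group a) G"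
    for C' C :: "('k, 'g, 'p) bundle_connection" and \<psi>' \<psi> \<chi>' \<chi>
  proof -
    have "(\<chi>, \<chi>') \<in> ?s"
      using equivalent_imp_hom_equiv[of G "fst C'" "snd C'" "fst C" "snd C"] that
      by (auto simp: flat_connections_def)
    then show ?thesis using s by (meson equivE symD)
  qed
  \<comment> \<open>The base point is chosen implicitly with the homomorphism; other choices only
    conjugate it.\<close>
  define \<chi> where "\<chi> C = (SOME \<chi>. \<chi> \<in> hom (fundamental_group a) G \<and> (\<exists>\<psi>. holonomy_at C a \<psi> \<chi>))"
    for C :: "('k, 'g, 'p) bundle_connection"
  have \<chi>: "\<chi> C \<in> hom (fundamental_group a) G \<and> (\<exists>\<psi>. holonomy_at C a \<psi> (\<chi> C))"
    if "C \<in> flat_connections G" for C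
    unfolding \<chi>_def using flat_connection_ex_holonomy[OF that, of a]
    by (intro someI_ex[of "\<lambda>\<chi>. \<chi> \<in> hom (fundamental_group a) G \<and> (\<exists>\<psi>. holonomy_at C a \<psi> \<chi>)"]) blast
  \<comment> \<open>This exhibits equivalence of connections as the pull-back of conjugacy along the
    chosen holonomies.\<close>
  have equiv_iff: "connections_equivalent G C' C \<longleftrightarrow> (\<chi> C', \<chi> C) \<in> ?s"
    if C': "C' \<in> flat_connections G" and C: "C \<in> flat_connections G" for C' C
  proof
    show "(\<chi> C', \<chi> C) \<in> ?s" if "connections_equivalent G C' C"
      using hom_equiv[OF C' C that] \<chi>[OF C'] \<chi>[OF C] by blast
    assume "(\<chi> C', \<chi> C) \<in> ?s"
    then have "(\<chi> C, \<chi> C') \<in> ?s" using s by (meson equivE symD)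
    then show "connections_equivalent G C' C"
      using hom_equiv_imp_equivalent[OF assms(2), of G "fst C'" "snd C'" "fst C" "snd C"]
        \<chi>[OF C'] \<chi>[OF C] C' C
      by (auto simp: flat_connections_def)
  qed
  show "\<exists>\<Phi>. bij_betw \<Phi>
      ((flat_connections G :: ('k, 'g, 'p) bundle_connection set) // flat_connection_equiv G)
      (hom (fundamental_group a) G // ?s)"
  proof (rule ex_bij_betw_quotient[OF s, where h = \<chi>])
    show "\<chi> ` flat_connections G \<subseteq> hom (fundamental_group a) G" using \<chi> by blast
    show "flat_connection_equiv G \<subseteq>
        flat_connections G \<times> (flat_connections G :: ('k, 'g, 'p) bundle_connection set)"
      by (auto simp: flat_connection_equiv_def)
    show "(C', C) \<in> flat_connection_equiv G \<longleftrightarrow> (\<chi> C', \<chi> C) \<in> ?s"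
      if "C' \<in> flat_connections G" "C \<in> flat_connections G" for C' C
      using equiv_iff that by (simp add: flat_connection_equiv_def)
    fix \<eta> assume \<eta>: "\<eta> \<in> hom (fundamental_group a) G"
    then obtain C \<psi> where C: "C \<in> (flat_connections G :: ('k, 'g, 'p) bundle_connection set)"
      and hol: "holonomy_at C a \<psi> \<eta>"
      using realize by blast
    \<comment> \<open>Reflexivity is inherited from conjugacy. It allows \<open>hom_equiv\<close> to
      compare \<open>C\<close> with itself, where \<open>\<chi> C\<close> and \<open>\<eta>\<close>
      are two holonomies, possibly at different base points.\<close>
    moreover have "connections_equivalent G C C"
      using equiv_iff[OF C C] \<chi>[OF C] s by (meson equivE refl_onD)
    ultimately have "(\<chi> C, \<eta>) \<in> ?s"
      using hom_equiv[OF C C] \<chi>[OF C] \<eta> by blast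
    with C show "\<exists>C\<in>flat_connections G. (\<chi> C, \<eta>) \<in> ?s" by blast
  qed
  fix C :: "('k, 'g, 'q) bundle_connection" assume C: "C \<in> flat_connections G"
  then obtain \<eta> \<psi> where \<eta>: "\<eta> \<in> hom (fundamental_group a) G" and hol: "holonomy_at C a \<psi> \<eta>"
    using flat_connection_ex_holonomy by blast
  \<comment> \<open>Realize the holonomy of \<open>C\<close> itself in the type \<open>'p\<close>;
    matching transports works across different types of total spaces.\<close>
  obtain C' \<psi>' where C': "C' \<in> (flat_connections G :: ('k, 'g, 'p) bundle_connection set)"
    and hol': "holonomy_at C' a \<psi>' \<eta>"
    using realize[OF \<eta>] by blast
  have "connections_equivalent G C C'"
    using same_holonomy_imp_equivalent[OF assms(2) _ _ \<eta>, of "fst C" "snd C" "fst C'" "snd C'"]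
      C C' hol hol' by (auto simp: flat_connections_def)
  with C' show "\<exists>C' \<in> (flat_connections G :: ('k, 'g, 'p) bundle_connection set).
      connections_equivalent G C C'" by blast
qed

end
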